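(* Let $T>0$, $g\in L^2(\mathbb R_+)$, $G=\Phi g$, and suppose that the function $r\mapsto e^{\frac r{4T}}g(r)\big/\ln\left(1+\frac{4T}r\right)$ belongs to $L^\infty(\mathbb R_+)$. Then $G$ can be extended to an entire function $G_e$ of order $\le1$ and type $\le T$.
   Context: $\mathbb R_+=(0,+\infty)$. The operator $\Phi:L^2(\mathbb R_+)\to L^2(\mathbb R_+)$ is $\Phi=\Psi\mathscr F\Psi^{-1}$, where $(\Psi^{-1}g)(x)=g(|x|^2)$, $x\in\mathbb R^2$, maps $L^2(\mathbb R_+)$ onto the space $\mathcal H$ of radial functions in $L^2(\mathbb R^2)$, $\Psi$ is its inverse, and $\mathscr F$ is the unitary Fourier transform $(\mathscr Ff)(\sigma)=\frac1{2\pi}\iint f(x)e^{-i\langle x,\sigma\rangle}dx$ on $L^2(\mathbb R^2)$. Equivalently, $(\Phi g)(\rho)=\frac12\lim_{N\to\infty}\int_0^Ng(r)J_0(\sqrt{r\rho})\,dr$ (limit in $L^2(\mathbb R_+)$), $J_0$ being the Bessel function of order $0$. An entire function $E$ on $\mathbb C$ is of order $\le1$ and type $\le T$ if for every $\varepsilon>0$ there is $C_\varepsilon$ with $|E(z)|\le C_\varepsilon e^{(T+\varepsilon)|z|}$ for all $z\in\mathbb C$. "Extended" means agreement a.e. on $\mathbb R_+$. *)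

theory Defs
  imports "HOL-Analysis.Analysis"
begin

(* Elements of L^2 and L^\<infinity> are given by Borel representatives; every class of Lebesgue
   measurable functions modulo null sets contains one. *)

definition Rplus :: "real measure" where
  "Rplus = restrict_space lborel {0<..}"

definition in_L2 :: "'a measure \<Rightarrow> ('a \<Rightarrow> complex) \<Rightarrow> bool" where
  "in_L2 M f \<longleftrightarrow> f \<in> borel_measurable M \<and> integrable M (\<lambda>x. (cmod (f x))\<^sup>2)"

definition in_Linf :: "'a measure \<Rightarrow> ('a \<Rightarrow> complex) \<Rightarrow> bool" where
  "in_Linf M f \<longleftrightarrow> f \<in> borel_measurable M \<and> (\<exists>C. AE x in M. cmod (f x) \<le> C)"

(* The plane is real \<times> real, whose library norm and inner product are the Euclidean ones. *)

definition fourier_trunc :: "(real \<times> real \<Rightarrow> complex) \<Rightarrow> real \<Rightarrow> real \<times> real \<Rightarrow> complex" where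
  "fourier_trunc f R \<sigma> =
     1 / (2 * of_real pi) * (LINT x:cball 0 R|lborel. f x * exp (- \<i> * of_real (x \<bullet> \<sigma>)))"

(* Graph of the unitary Fourier transform on L^2 of the plane: h represents the transform of f
   iff h is the L^2 limit of the truncated Fourier integrals of f (each of which converges
   absolutely). The distance is a nonnegative integral, which is infinite, not 0, when the
   difference is not square integrable. *)

definition fourier_L2 :: "(real \<times> real \<Rightarrow> complex) \<Rightarrow> (real \<times> real \<Rightarrow> complex) \<Rightarrow> bool" where
  "fourier_L2 f h \<longleftrightarrow> in_L2 lborel f \<and> in_L2 lborel h \<and>
     ((\<lambda>R. \<integral>\<^sup>+\<sigma>. ennreal ((cmod (fourier_trunc f R \<sigma> - h \<sigma>))\<^sup>2) \<partial>lborel) \<longlongrightarrow> 0) at_top"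

definition Psi_inv :: "(real \<Rightarrow> complex) \<Rightarrow> real \<times> real \<Rightarrow> complex" where
  "Psi_inv g x = g ((norm x)\<^sup>2)"

(* Graph of the operator \<Phi> = \<Psi> F \<Psi>^(-1), with F the Fourier transform above:
   G represents \<Phi> g iff \<Psi>^(-1) G represents F (\<Psi>^(-1) g). *)

definition is_Phi :: "(real \<Rightarrow> complex) \<Rightarrow> (real \<Rightarrow> complex) \<Rightarrow> bool" where
  "is_Phi g G \<longleftrightarrow> in_L2 Rplus g \<and> in_L2 Rplus G \<and> fourier_L2 (Psi_inv g) (Psi_inv G)"

definition entire_order1_type_le :: "real \<Rightarrow> (complex \<Rightarrow> complex) \<Rightarrow> bool" where
  "entire_order1_type_le T E \<longleftrightarrow> E holomorphic_on UNIV \<and>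
     (\<forall>\<epsilon>>0. \<exists>C. \<forall>z. cmod (E z) \<le> C * exp ((T + \<epsilon>) * cmod z))"

end

theory Submission imports Defs
begin

text \<open>The transform of the radial function \<open>f x = g (\<bar>x\<bar>\<^sup>2)\<close> at \<open>\<sigma>\<close> equals its value at
  \<open>(\<bar>\<sigma>\<bar>, 0)\<close>, the integral of \<open>f x cos (x\<^sub>1 \<bar>\<sigma>\<bar>) / (2\<pi>)\<close>. The cosine being even,
  replacing \<open>\<bar>\<sigma>\<bar>\<close> by a square root of \<open>z\<close> gives a power series in \<open>z\<close>, which extends \<open>G\<close>. Its growth is controlled by \<open>\<bar>cos w\<bar> \<le> e\<^sup>\<bar>\<^sup>w\<^sup>\<bar>\<close> and
  \<open>\<bar>x\<^sub>1\<bar> \<bar>z\<bar>\<^sup>1\<^sup>/\<^sup>2 \<le> x\<^sub>1\<^sup>2 / (4 (T + \<epsilon>)) + (T + \<epsilon>) \<bar>z\<bar>\<close>: the decay of \<open>g\<close> makes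
  \<open>\<bar>f x\<bar> exp (x\<^sub>1\<^sup>2 / (4 (T + \<epsilon>)))\<close> integrable.\<close>

section \<open>Unimodular linear maps of the plane\<close>

text \<open>Two one-dimensional affine substitutions, exchanged by Fubini, contribute the factors
  \<open>1/|a|\<close> and \<open>1/|e|\<close>, whose product is \<open>1/|det| = 1\<close>. The
  first one divides by \<open>a\<close>. The lemma is applied to rotations.\<close>

lemma distr_lborel_linear_plane:
  fixes a b c d :: real
  assumes "a \<noteq> 0" and det: "\<bar>a * d - b * c\<bar> = 1"
  shows "distr lborel borel (\<lambda>x. (a * fst x + b * snd x, c * fst x + d * snd x)) = lborel"
proof (rule measure_eqI)
  fix S :: "(real \<times> real) set"
  assume "S \<in> sets (distr lborel borel (\<lambda>x. (a * fst x + b * snd x, c * fst x + d * snd x)))"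
  then have [measurable]: "S \<in> sets borel" by simp
  have [measurable]: "S \<in> sets (borel \<Otimes>\<^sub>M borel)" using \<open>S \<in> sets borel\<close> by (simp only: borel_prod)
  let ?\<phi> = "\<lambda>x. indicator S x :: ennreal"
  \<comment> \<open>Eliminating \<open>x\<close> through \<open>u = a * x + b * y\<close> turns
    \<open>c * x + d * y\<close> into \<open>(c/a) * u + e * y\<close>, so \<open>e\<close> is the
    scale of the second substitution.\<close>
  define e where "e = (a * d - b * c) / a"
  have e0: "e \<noteq> 0" and ae: "\<bar>a\<bar> * \<bar>e\<bar> = 1"
    using assms by (auto simp: e_def)
  have "emeasure (distr lborel borel (\<lambda>x. (a * fst x + b * snd x, c * fst x + d * snd x))) S
    = (\<integral>\<^sup>+x. ?\<phi> x \<partial>distr lborel borel (\<lambda>x. (a * fst x + b * snd x, c * fst x + d * snd x)))"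
    by simp
  also have "\<dots> = (\<integral>\<^sup>+x. ?\<phi> (a * fst x + b * snd x, c * fst x + d * snd x) \<partial>(lborel \<Otimes>\<^sub>M lborel))"
    by (subst nn_integral_distr)
      (auto simp: lborel_prod intro!: borel_measurable_continuous_onI continuous_intros)
  also have "\<dots> = (\<integral>\<^sup>+y. \<integral>\<^sup>+x. ?\<phi> (a * x + b * y, c * x + d * y) \<partial>lborel \<partial>lborel)"
    by (subst lborel_pair.nn_integral_snd[symmetric]) auto
  also have "\<dots> = (\<integral>\<^sup>+y. \<integral>\<^sup>+u. ennreal \<bar>1/a\<bar> * ?\<phi> (u, (c/a) * u + e * y) \<partial>lborel \<partial>lborel)"
  proof (rule nn_integral_cong)
    fix y :: real
    have "(\<integral>\<^sup>+x. ?\<phi> (a * x + b * y, c * x + d * y) \<partial>lborel)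
      = ennreal \<bar>1/a\<bar> * (\<integral>\<^sup>+u. ?\<phi> (a * (- (b * y / a) + 1/a * u) + b * y, c * (- (b * y / a) + 1/a * u) + d * y) \<partial>lborel)"
      by (rule nn_integral_real_affine) (use \<open>a \<noteq> 0\<close> in auto)
    also have "\<dots> = (\<integral>\<^sup>+u. ennreal \<bar>1/a\<bar> * ?\<phi> (u, (c/a) * u + e * y) \<partial>lborel)"
      using \<open>a \<noteq> 0\<close> by (subst nn_integral_cmult[symmetric]) (auto simp: e_def field_simps)
    finally show "(\<integral>\<^sup>+x. ?\<phi> (a * x + b * y, c * x + d * y) \<partial>lborel) = \<dots>" .
  qed
  also have "\<dots> = (\<integral>\<^sup>+u. \<integral>\<^sup>+y. ennreal \<bar>1/a\<bar> * ?\<phi> (u, (c/a) * u + e * y) \<partial>lborel \<partial>lborel)"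
    by (rule lborel_pair.Fubini') measurable
  also have "\<dots> = (\<integral>\<^sup>+u. \<integral>\<^sup>+v. ?\<phi> (u, v) \<partial>lborel \<partial>lborel)"
  proof (rule nn_integral_cong)
    fix u :: real
    have "(\<integral>\<^sup>+v. ?\<phi> (u, v) \<partial>lborel) = ennreal \<bar>e\<bar> * (\<integral>\<^sup>+y. ?\<phi> (u, (c/a) * u + e * y) \<partial>lborel)"
      by (rule nn_integral_real_affine) (use e0 in auto)
    moreover have "ennreal \<bar>e\<bar> = ennreal \<bar>1/a\<bar>"
      using ae \<open>a \<noteq> 0\<close> by (simp add: field_simps)
    ultimately show "(\<integral>\<^sup>+y. ennreal \<bar>1/a\<bar> * ?\<phi> (u, (c/a) * u + e * y) \<partial>lborel) = (\<integral>\<^sup>+v. ?\<phi> (u, v) \<partial>lborel)"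
      by (simp add: nn_integral_cmult)
  qed
  also have "\<dots> = (\<integral>\<^sup>+x. ?\<phi> x \<partial>(lborel \<Otimes>\<^sub>M lborel))"
    by (subst lborel.nn_integral_fst) auto
  also have "\<dots> = emeasure lborel S"
    by (simp add: lborel_prod)
  finally show "emeasure (distr lborel borel (\<lambda>x. (a * fst x + b * snd x, c * fst x + d * snd x))) S
    = emeasure lborel S" .
qed simp

section \<open>The squared norm as radial variable\<close>

text \<open>The disc of radius \<open>sqrt t\<close> has area \<open>pi * t\<close>, so both
  measures agree on the half-lines \<open>{..t}\<close>, which generate the Borel sets and are
  closed under intersection. Thus \<open>r = |x|^2\<close> has constant density
  \<open>pi\<close>.\<close>

lemma distr_lborel_norm_square_plane:
  "distr lborel borel (\<lambda>x :: real \<times> real. (norm x)\<^sup>2)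
    = density lborel (\<lambda>r. ennreal pi * indicator {0<..} r)"
  (is "?M = ?N")
proof (rule measure_eqI_generator_eq[where E = "range atMost" and \<Omega> = UNIV and A = "\<lambda>n. {..real n}"])
  show "Int_stable (range (atMost :: real \<Rightarrow> real set))"
    by (auto simp: Int_stable_def)
  have M: "emeasure ?M {..t} = ennreal (pi * max 0 t)" for t
  proof -
    have "emeasure ?M {..t} = emeasure lborel {x :: real \<times> real. (norm x)\<^sup>2 \<le> t}"
      by (subst emeasure_distr) (auto simp: vimage_def)
    also have "\<dots> = ennreal (pi * max 0 t)"
    proof (cases "t \<ge> 0")
      case True
      then have "{x :: real \<times> real. (norm x)\<^sup>2 \<le> t} = cball 0 (sqrt t)"
        by (auto simp: real_le_rsqrt sqrt_ge_absD)
      then show ?thesis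
        using True by (simp add: emeasure_cball unit_ball_vol_2)
    next
      case False
      have "\<not> (norm x)\<^sup>2 \<le> t" for x :: "real \<times> real"
        using False zero_le_power2[of "norm x"] by linarith
      then show ?thesis using False by (simp del: norm_Pair)
    qed
    finally show ?thesis .
  qed
  have N: "emeasure ?N {..t} = ennreal (pi * max 0 t)" for t
  proof -
    have "emeasure ?N {..t} = (\<integral>\<^sup>+r. ennreal pi * indicator {0<..t} r \<partial>lborel)"
      by (subst emeasure_density) (auto intro!: nn_integral_cong split: split_indicator)
    also have "\<dots> = ennreal pi * emeasure lborel {0<..t}"
      by (simp add: nn_integral_cmult)
    also have "\<dots> = ennreal (pi * max 0 t)"
      by (cases "t \<ge> 0") (auto simp: ennreal_mult)
    finally show ?thesis .
  qed
  show "emeasure ?M X = emeasure ?N X" if "X \<in> range atMost" for X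
    using that M N by auto
  show "emeasure ?M {..real i} \<noteq> \<infinity>" for i
    by (simp add: M)
  show "(\<Union>i. {..real i}) = UNIV"
    by (auto intro: real_arch_simple)
qed (auto simp: borel_eq_atMost)

lemma AE_Rplus_iff: "(AE r in Rplus. P r) \<longleftrightarrow> (AE r in lborel. 0 < r \<longrightarrow> P r)"
  unfolding Rplus_def by (subst AE_restrict_space_iff) auto

lemma AE_norm_square_plane:
  assumes "AE r in Rplus. P r"
  shows "AE x in lborel. P ((norm (x :: real \<times> real))\<^sup>2)"
proof -
  have "AE r in lborel. 0 < r \<longrightarrow> P r"
    using assms by (simp add: AE_Rplus_iff)
  then have "AE r in density lborel (\<lambda>r. ennreal pi * indicator {0<..} r). P r"
    by (subst AE_density) (auto split: split_indicator)
  then show ?thesis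
    unfolding distr_lborel_norm_square_plane[symmetric] by (rule AE_distrD[rotated]) simp
qed

text \<open>This carries a statement from the plane back to the half-line;
  \<open>AE_distr_iff\<close> asks for the measurability of the set where \<open>P\<close>
  holds.\<close>

lemma AE_norm_square_plane_iff:
  assumes [measurable]: "{r. P r} \<in> sets borel"
  shows "(AE x in lborel. P ((norm (x :: real \<times> real))\<^sup>2)) \<longleftrightarrow> (AE r in Rplus. P r)"
proof -
  have "(AE x in lborel. P ((norm (x :: real \<times> real))\<^sup>2))
    \<longleftrightarrow> (AE r in distr lborel borel (\<lambda>x :: real \<times> real. (norm x)\<^sup>2). P r)"
    by (rule AE_distr_iff[symmetric]) auto
  also have "\<dots> \<longleftrightarrow> (AE r in Rplus. P r)"
    unfolding distr_lborel_norm_square_plane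
    by (subst AE_density) (auto simp: AE_Rplus_iff indicator_def)
  finally show ?thesis .
qed

lemma integrable_norm_square_plane:
  fixes \<phi> :: "real \<Rightarrow> real"
  assumes [measurable]: "\<phi> \<in> borel_measurable borel" and "set_integrable lborel {0<..} \<phi>"
  shows "integrable lborel (\<lambda>x :: real \<times> real. \<phi> ((norm x)\<^sup>2))"
proof -
  have "integrable lborel (\<lambda>r. (pi * indicator {0<..} r) *\<^sub>R \<phi> r)"
    using integrable_mult_right[OF assms(2)[unfolded set_integrable_def], of pi]
    by (simp add: mult.assoc)
  then have "integrable (density lborel (\<lambda>r. ennreal (pi * indicator {0<..} r))) \<phi>"
    by (subst integrable_density) auto
  also have "(\<lambda>r. ennreal (pi * indicator {0<..} r)) = (\<lambda>r. ennreal pi * indicator {0<..} r)"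
    by (auto split: split_indicator)
  finally show ?thesis
    unfolding distr_lborel_norm_square_plane[symmetric] by (subst (asm) integrable_distr_eq) auto
qed

section \<open>Integrability of the radial majorant\<close>

text \<open>The singularity at 0 is tamed by \<open>ln (1 + b/r) \<le> 2 * sqrt (b/r)\<close>; what
  remains is a multiple of the Gamma integrand with exponent 1/2.\<close>

lemma set_integrable_exp_ln:
  fixes a b :: real
  assumes "a > 0" "b > 0"
  shows "set_integrable lborel {0<..} (\<lambda>r. exp (- (a * r)) * ln (1 + b / r))"
proof -
  have "(\<lambda>t. complex_of_real t powr (1/2 - 1) / of_real (exp (a * t))) absolutely_integrable_on {0<..}"
    using absolutely_integrable_Gamma_integral[of "1/2" a] assms by simp
  \<comment> \<open>Absolute integrability refers to the completed measure; Borel measurability of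
    the integrand brings it down to \<open>lborel\<close>.\<close>
  then have "set_integrable lborel {0<..}
      (\<lambda>t. complex_of_real t powr (1/2 - 1) / of_real (exp (a * t)))"
    unfolding set_integrable_def
    by (subst (asm) integrable_completion) (auto intro!: borel_measurable_continuous_on_indicator continuous_intros)
  then have "integrable lborel (\<lambda>t. (2 * sqrt b) * norm (indicator {0<..} t *\<^sub>R
      (complex_of_real t powr (1/2 - 1) / of_real (exp (a * t)))))"
    unfolding set_integrable_def by (intro integrable_mult_right integrable_norm)
  then show ?thesis
    unfolding set_integrable_def
  proof (rule Bochner_Integration.integrable_bound)
    show "AE r in lborel. norm (indicator {0<..} r *\<^sub>R (exp (- (a * r)) * ln (1 + b / r)))
      \<le> norm ((2 * sqrt b) * norm (indicator {0<..} r *\<^sub>R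
      (complex_of_real r powr (1/2 - 1) / of_real (exp (a * r)))))"
    proof (rule AE_I2)
      fix r :: real
      show "norm (indicator {0<..} r *\<^sub>R (exp (- (a * r)) * ln (1 + b / r)))
      \<le> norm ((2 * sqrt b) * norm (indicator {0<..} r *\<^sub>R
      (complex_of_real r powr (1/2 - 1) / of_real (exp (a * r)))))"
      proof (cases "r > 0")
        case True
        \<comment> \<open>With \<open>s = sqrt (b / r)\<close> this is
          \<open>1 + s^2 \<le> (1 + s)^2\<close>; then \<open>ln (1 + s) \<le> s\<close> finishes
          the estimate.\<close>
        have "1 + b / r \<le> (1 + sqrt (b / r))\<^sup>2"
          using True assms by (simp add: power2_sum)
        then have "ln (1 + b / r) \<le> ln ((1 + sqrt (b / r))\<^sup>2)"
          using True assms by (intro ln_mono) (auto intro!: add_pos_pos divide_pos_pos)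
        also have "\<dots> = 2 * ln (1 + sqrt (b / r))"
          by (subst ln_realpow) (use True assms in \<open>auto intro!: add_pos_nonneg simp del: real_sqrt_divide\<close>)
        also have "\<dots> \<le> 2 * sqrt (b / r)"
          using ln_add_one_self_le_self[of "sqrt (b / r)"] True assms by simp
        finally have ln: "ln (1 + b / r) \<le> 2 * sqrt b / sqrt r"
          by (simp add: real_sqrt_divide)
        have "norm (complex_of_real r powr (1/2 - 1)) = r powr (- (1/2))"
          using True by (subst norm_powr_real_powr) auto
        also have "\<dots> = 1 / sqrt r"
          using True by (simp add: powr_minus powr_half_sqrt inverse_eq_divide)
        finally have n: "norm (complex_of_real r powr (1/2 - 1)) = 1 / sqrt r" .
        have l0: "0 \<le> ln (1 + b / r)" using True assms by simp
        have "norm (indicator {0<..} r *\<^sub>R (exp (- (a * r)) * ln (1 + b / r)))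
          = exp (- (a * r)) * ln (1 + b / r)"
          using True l0 by (simp add: abs_mult)
        also have "\<dots> \<le> exp (- (a * r)) * (2 * sqrt b / sqrt r)"
          using ln by (intro mult_left_mono) auto
        also have "\<dots> = norm ((2 * sqrt b) * norm (indicator {0<..} r *\<^sub>R
            (complex_of_real r powr (1/2 - 1) / of_real (exp (a * r)))))"
          using True assms n by (simp add: norm_divide norm_mult abs_mult exp_minus field_simps)
        finally show ?thesis .
      qed auto
    qed
  qed measurable
qed

section \<open>Cosine transforms in a square root of the variable\<close>

text \<open>Consecutive terms of the full cosine series are grouped in pairs, the odd one being 0.
  Even powers alone make a series in \<open>w^2\<close>.\<close>

lemma cos_even_sums:
  fixes w :: "'a::{real_normed_field,banach}"
  shows "(\<lambda>n. (- 1) ^ n / fact (2 * n) * w ^ (2 * n)) sums cos w"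
proof -
  have "(\<lambda>n. \<Sum>k = n * 2..<n * 2 + 2. cos_coeff k *\<^sub>R w ^ k) sums cos w"
    by (rule sums_group) (use cos_converges[of w] in auto)
  moreover have "(\<Sum>k = n * 2..<n * 2 + 2. cos_coeff k *\<^sub>R w ^ k)
      = (- 1) ^ n / fact (2 * n) * w ^ (2 * n)" for n
    by (simp add: cos_coeff_def scaleR_conv_of_real mult.commute)
  ultimately show ?thesis by simp
qed

text \<open>The even terms are part of the nonnegative exponential series. The bound is uniform in
  \<open>N\<close>, as the later exchange of sum and integral requires.\<close>

lemma sum_even_exp_le:
  fixes t :: real
  assumes "t \<ge> 0"
  shows "(\<Sum>n<N. t ^ (2 * n) / fact (2 * n)) \<le> exp t"
proof -
  have "(\<Sum>n<N. t ^ (2 * n) / fact (2 * n)) = (\<Sum>m\<in>(\<lambda>n. 2 * n) ` {..<N}. t ^ m / fact m)"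
    by (subst sum.reindex) (auto simp: inj_on_def)
  also have "\<dots> \<le> (\<Sum>m. t ^ m / fact m)"
    using summable_exp_generic[of t] assms
    by (intro sum_le_suminf) (auto simp: scaleR_conv_of_real divide_inverse mult.commute)
  also have "\<dots> = exp t"
    by (simp add: exp_def scaleR_conv_of_real divide_inverse mult.commute)
  finally show ?thesis .
qed

text \<open>Termwise integration of the cosine series leaves only even powers of
  \<open>csqrt z\<close>, hence a power series in \<open>z\<close> without trace of the branch cut.
  The growth bound is separate and uses the Gaussian weight with \<open>c\<close> close to
  \<open>T\<close>.\<close>

lemma entire_cos_csqrt_transform:
  fixes f :: "'a \<Rightarrow> complex" and X :: "'a \<Rightarrow> real"
  assumes [measurable]: "f \<in> borel_measurable M" "X \<in> borel_measurable M"
    and T: "T \<ge> 0"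
    and int: "\<And>c. c > T \<Longrightarrow> integrable M (\<lambda>x. cmod (f x) * exp ((X x)\<^sup>2 / (4 * c)))"
  shows "entire_order1_type_le T (\<lambda>z. \<integral>x. f x * cos (of_real (X x) * csqrt z) \<partial>M)"
    (is "entire_order1_type_le T ?E")
proof -
  have young: "\<bar>X x\<bar> * s \<le> (X x)\<^sup>2 / (4 * c) + c * s\<^sup>2" if "c > 0" for x s and c :: real
  proof -
    \<comment> \<open>Divided by \<open>4 * c\<close>, this square separates the Gaussian weight
      \<open>1 / (4 * c)\<close> from the coefficient \<open>c\<close> of \<open>s^2\<close>, which
      becomes the exponential type.\<close>
    have "0 \<le> (\<bar>X x\<bar> - 2 * c * s)\<^sup>2" by simp
    then have "4 * c * (\<bar>X x\<bar> * s) \<le> (X x)\<^sup>2 + 4 * c * (c * s\<^sup>2)"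
      by (simp add: power2_diff power_mult_distrib algebra_simps power2_eq_square)
    then show ?thesis
      using that by (simp add: field_simps power2_eq_square)
  qed
  have int_exp: "integrable M (\<lambda>x. cmod (f x) * exp (\<bar>X x\<bar> * s))" for s
  proof (rule Bochner_Integration.integrable_bound)
    \<comment> \<open>Only finiteness is wanted here, so any \<open>c > T\<close> serves;
      \<open>T + 1\<close> is one.\<close>
    show "integrable M (\<lambda>x. (cmod (f x) * exp ((X x)\<^sup>2 / (4 * (T + 1)))) * exp ((T + 1) * s\<^sup>2))"
      by (intro integrable_mult_left int) simp
    show "AE x in M. norm (cmod (f x) * exp (\<bar>X x\<bar> * s))
        \<le> norm ((cmod (f x) * exp ((X x)\<^sup>2 / (4 * (T + 1)))) * exp ((T + 1) * s\<^sup>2))"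
    proof (rule AE_I2)
      fix x
      have "exp (\<bar>X x\<bar> * s) \<le> exp ((X x)\<^sup>2 / (4 * (T + 1)) + (T + 1) * s\<^sup>2)"
        using young[of "T + 1" x s] T by simp
      then show "norm (cmod (f x) * exp (\<bar>X x\<bar> * s))
        \<le> norm ((cmod (f x) * exp ((X x)\<^sup>2 / (4 * (T + 1)))) * exp ((T + 1) * s\<^sup>2))"
        by (simp add: abs_mult mult.assoc mult_left_mono flip: exp_add)
    qed
  qed measurable
  have cos_le: "cmod (f x * cos (of_real (X x) * csqrt z)) \<le> cmod (f x) * exp (\<bar>X x\<bar> * sqrt (cmod z))"
    for x z
    using norm_cos_le[of "of_real (X x) * csqrt z"]
    by (auto simp: norm_mult norm_csqrt intro!: mult_left_mono)
  have int_cos: "integrable M (\<lambda>x. f x * cos (of_real (X x) * csqrt z))" for z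
    by (rule Bochner_Integration.integrable_bound[OF int_exp[of "sqrt (cmod z)"]])
      (use cos_le in auto)
  have meas_bound: "cmod (?E z) \<le> (\<integral>x. cmod (f x) * exp (\<bar>X x\<bar> * sqrt (cmod z)) \<partial>M)" for z
    by (rule order_trans[OF integral_norm_bound])
      (intro integral_mono integrable_norm int_cos int_exp cos_le)
  \<comment> \<open>\<open>h n z\<close> is the \<open>n\<close>-th term of the cosine series of the
    integrand, written with \<open>z ^ n\<close> in place of
    \<open>csqrt z ^ (2 * n)\<close>.\<close>
  define h where "h n z x = f x * ((- 1) ^ n / fact (2 * n) * of_real (X x) ^ (2 * n) * z ^ n)" for n z x
  have h_meas [measurable]: "h n z \<in> borel_measurable M" for n z
    unfolding h_def by measurable
  have norm_h: "cmod (h n z x) = cmod (f x) * ((\<bar>X x\<bar> * sqrt (cmod z)) ^ (2 * n) / fact (2 * n))" for n z x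
    by (simp add: h_def norm_mult norm_divide norm_power power_mult_distrib power_mult)
  have sum_h: "(\<Sum>n<N. cmod (h n z x)) \<le> cmod (f x) * exp (\<bar>X x\<bar> * sqrt (cmod z))" for N z x
    unfolding norm_h sum_distrib_left[symmetric]
    by (intro mult_left_mono sum_even_exp_le) auto
  have int_h: "integrable M (h n z)" for n z
  proof (rule Bochner_Integration.integrable_bound[OF int_exp[of "sqrt (cmod z)"]])
    \<comment> \<open>A single term is at most the partial sum that includes it, so
      \<open>sum_h\<close> at \<open>Suc n\<close> dominates it.\<close>
    have "cmod (h n z x) \<le> (\<Sum>k<Suc n. cmod (h k z x))" for x
      by (simp add: sum_nonneg)
    then show "AE x in M. norm (h n z x) \<le> norm (cmod (f x) * exp (\<bar>X x\<bar> * sqrt (cmod z)))"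
      using sum_h[of z _ "Suc n"] by (intro AE_I2) (auto intro: order_trans simp del: sum.lessThan_Suc)
  qed measurable
  have h_sums: "(\<lambda>n. h n z x) sums (f x * cos (of_real (X x) * csqrt z))" for z x
  proof -
    have "(of_real (X x) * csqrt z) ^ (2 * n) = of_real (X x) ^ (2 * n) * z ^ n" for n
      by (simp add: power_mult_distrib power_mult)
    then show ?thesis
      using sums_mult[OF cos_even_sums[of "of_real (X x) * csqrt z"], of "f x"]
      by (simp add: h_def mult.assoc)
  qed
  define a where "a n = (\<integral>x. h n 1 x \<partial>M)" for n
  have a: "(\<integral>x. h n z x \<partial>M) = a n * z ^ n" for n z
  proof -
    have "h n z x = h n 1 x * z ^ n" for x
      by (simp add: h_def)
    then show ?thesis
      by (simp add: a_def)
  qed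
  have E_sums: "(\<lambda>n. a n * z ^ n) sums ?E z" for z
  proof -
    \<comment> \<open>Both absolute summability conditions, pointwise and for the integrals, follow
      from the majorant in \<open>sum_h\<close>, which is independent of \<open>N\<close>.\<close>
    have "(\<lambda>n. \<integral>x. h n z x \<partial>M) sums (\<integral>x. (\<Sum>n. h n z x) \<partial>M)"
    proof (rule sums_integral)
      show "AE x in M. summable (\<lambda>n. norm (h n z x))"
        using sum_h by (intro AE_I2 summableI_nonneg_bounded) auto
      show "summable (\<lambda>n. \<integral>x. norm (h n z x) \<partial>M)"
      proof (rule summableI_nonneg_bounded)
        fix N
        have "(\<Sum>n<N. \<integral>x. norm (h n z x) \<partial>M) = (\<integral>x. (\<Sum>n<N. norm (h n z x)) \<partial>M)"
          by (rule Bochner_Integration.integral_sum[symmetric]) (intro integrable_norm int_h)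
        also have "\<dots> \<le> (\<integral>x. cmod (f x) * exp (\<bar>X x\<bar> * sqrt (cmod z)) \<partial>M)"
          by (intro integral_mono int_exp sum_h Bochner_Integration.integrable_sum integrable_norm int_h)
        finally show "(\<Sum>n<N. \<integral>x. norm (h n z x) \<partial>M) \<le> \<dots>" .
      qed simp
    qed (rule int_h)
    then show ?thesis
      using h_sums[of z, THEN sums_unique] by (simp add: a)
  qed
  have E_eq: "?E = (\<lambda>z. \<Sum>n. a n * z ^ n)"
    using E_sums[THEN sums_unique] by simp
  have "?E holomorphic_on UNIV"
    unfolding E_eq holomorphic_on_def field_differentiable_def
    using termdiffs_strong_converges_everywhere[OF E_sums[THEN sums_summable]]
      has_field_derivative_at_within by blast
  moreover have "\<exists>C. \<forall>z. cmod (?E z) \<le> C * exp ((T + \<epsilon>) * cmod z)" if "\<epsilon> > 0" for \<epsilon>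
  \<comment> \<open>The constant stays schematic and is read off the end of the calculation: the
    weighted integral at \<open>c = T + \<epsilon>\<close>, which is free of
    \<open>z\<close>.\<close>
  proof (intro exI allI)
    fix z
    have i: "integrable M (\<lambda>x. cmod (f x) * exp ((X x)\<^sup>2 / (4 * (T + \<epsilon>))))"
      using that by (intro int) simp
    have "cmod (?E z) \<le> (\<integral>x. cmod (f x) * exp (\<bar>X x\<bar> * sqrt (cmod z)) \<partial>M)"
      by (rule meas_bound)
    also have "\<dots> \<le> (\<integral>x. (cmod (f x) * exp ((X x)\<^sup>2 / (4 * (T + \<epsilon>)))) * exp ((T + \<epsilon>) * cmod z) \<partial>M)"
    proof (intro integral_mono int_exp integrable_mult_left i)
      fix x
      have "exp (\<bar>X x\<bar> * sqrt (cmod z)) \<le> exp ((X x)\<^sup>2 / (4 * (T + \<epsilon>)) + (T + \<epsilon>) * cmod z)"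
        using young[of "T + \<epsilon>" x "sqrt (cmod z)"] T that by simp
      then show "cmod (f x) * exp (\<bar>X x\<bar> * sqrt (cmod z))
          \<le> (cmod (f x) * exp ((X x)\<^sup>2 / (4 * (T + \<epsilon>)))) * exp ((T + \<epsilon>) * cmod z)"
        by (simp add: mult.assoc mult_left_mono flip: exp_add)
    qed
    also have "\<dots> = (\<integral>x. cmod (f x) * exp ((X x)\<^sup>2 / (4 * (T + \<epsilon>))) \<partial>M) * exp ((T + \<epsilon>) * cmod z)"
      by simp
    finally show "cmod (?E z) \<le> \<dots>" .
  qed
  ultimately show ?thesis
    unfolding entire_order1_type_le_def by blast
qed

section \<open>Fourier integrals of radial functions\<close>

text \<open>A rotation takes \<open>\<sigma>\<close> to the first axis without changing
  \<open>f\<close> or Lebesgue measure, and averaging with the half-turn turns the exponential into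
  a cosine. \<open>fst \<sigma> \<noteq> 0\<close> makes the leading entry of the rotation matrix
  nonzero, as the change of variables demands.\<close>

lemma integral_radial_fourier_plane:
  fixes f :: "real \<times> real \<Rightarrow> complex"
  assumes f: "integrable lborel f"
    and radial: "\<And>x y. norm x = norm y \<Longrightarrow> f x = f y"
    and "fst \<sigma> \<noteq> 0"
  shows "(\<integral>x. f x * exp (- \<i> * of_real (x \<bullet> \<sigma>)) \<partial>lborel)
    = (\<integral>x. f x * cos (of_real (fst x * norm \<sigma>)) \<partial>lborel)"
proof -
  have [measurable]: "f \<in> borel_measurable borel"
    using f by auto
  have fst_meas [measurable]: "(fst :: real \<times> real \<Rightarrow> real) \<in> borel_measurable borel"
    by (intro borel_measurable_continuous_onI continuous_intros)
  define t where "t = norm \<sigma>"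
  define a where "a = fst \<sigma> / t"
  define b where "b = snd \<sigma> / t"
  have t: "t > 0" "t\<^sup>2 = (fst \<sigma>)\<^sup>2 + (snd \<sigma>)\<^sup>2"
    using \<open>fst \<sigma> \<noteq> 0\<close> unfolding t_def by (auto simp: norm_prod_def prod_eq_iff sum_power2_gt_zero_iff)
  have ab: "a * a + b * b = 1"
    using t by (simp add: a_def b_def divide_simps) (simp add: power2_eq_square)
  \<comment> \<open>Used twice: with \<open>(p, q) = (a, b)\<close> to align \<open>\<sigma>\<close>
    with the axis, and with \<open>(-1, 0)\<close> for the half-turn that reverses the sign of the
    frequency.\<close>
  have isometry: "(\<integral>x. f x * exp (\<i> * of_real (s * fst x)) \<partial>lborel)
      = (\<integral>x. f x * exp (\<i> * of_real (s * (p * fst x + q * snd x))) \<partial>lborel)"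
    if "p \<noteq> 0" "p * p + q * q = 1" for p q s
  proof -
    let ?A = "\<lambda>x. (p * fst x + q * snd x, - q * fst x + p * snd x)"
    have [measurable]: "?A \<in> borel_measurable borel"
      by (intro borel_measurable_continuous_onI continuous_intros)
    have "(p * u + q * v)\<^sup>2 + (- q * u + p * v)\<^sup>2 = (p * p + q * q) * (u\<^sup>2 + v\<^sup>2)" for u v
      by (simp add: power2_eq_square algebra_simps)
    then have n: "norm (?A x) = norm x" for x
      using that by (simp add: norm_prod_def)
    have "(\<integral>x. f x * exp (\<i> * of_real (s * fst x)) \<partial>lborel)
      = (\<integral>x. f x * exp (\<i> * of_real (s * fst x)) \<partial>distr lborel borel ?A)"
      by (subst distr_lborel_linear_plane) (use that in auto)
    also have "\<dots> = (\<integral>x. f (?A x) * exp (\<i> * of_real (s * fst (?A x))) \<partial>lborel)"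
      by (rule integral_distr) measurable
    also have "\<dots> = (\<integral>x. f x * exp (\<i> * of_real (s * (p * fst x + q * snd x))) \<partial>lborel)"
      by (simp only: radial[OF n] fst_conv)
    finally show ?thesis .
  qed
  have inner: "x \<bullet> \<sigma> = t * (a * fst x + b * snd x)" for x
    using t by (cases x; cases \<sigma>) (simp add: a_def b_def field_simps)
  have "(\<integral>x. f x * exp (- \<i> * of_real (x \<bullet> \<sigma>)) \<partial>lborel)
      = (\<integral>x. f x * exp (\<i> * of_real (- t * (a * fst x + b * snd x))) \<partial>lborel)"
    by (simp add: inner)
  also have "\<dots> = (\<integral>x. f x * exp (\<i> * of_real (- t * fst x)) \<partial>lborel)"
    using ab t \<open>fst \<sigma> \<noteq> 0\<close> by (intro isometry[symmetric]) (auto simp: a_def)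
  finally have minus: "(\<integral>x. f x * exp (- \<i> * of_real (x \<bullet> \<sigma>)) \<partial>lborel) = \<dots>" .
  also have "\<dots> = (\<integral>x. f x * exp (\<i> * of_real (t * fst x)) \<partial>lborel)"
    using isometry[of "-1" 0 "- t"] by simp
  finally have plus: "(\<integral>x. f x * exp (- \<i> * of_real (x \<bullet> \<sigma>)) \<partial>lborel) = \<dots>" .
  have i: "integrable lborel (\<lambda>x. f x * exp (\<i> * of_real (s * fst x)))" for s
    by (rule Bochner_Integration.integrable_bound[OF f]) (auto simp: norm_mult)
  \<comment> \<open>The forms with frequencies \<open>t\<close> and \<open>- t\<close> are added,
    and the exponentials combine to twice the cosine.\<close>
  have "2 * (\<integral>x. f x * exp (- \<i> * of_real (x \<bullet> \<sigma>)) \<partial>lborel)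
      = (\<integral>x. f x * exp (\<i> * of_real (t * fst x)) \<partial>lborel) + (\<integral>x. f x * exp (\<i> * of_real (- t * fst x)) \<partial>lborel)"
    using minus plus by simp
  also have "\<dots> = (\<integral>x. f x * exp (\<i> * of_real (t * fst x)) + f x * exp (\<i> * of_real (- t * fst x)) \<partial>lborel)"
    by (rule Bochner_Integration.integral_add[symmetric]; rule i)
  also have "\<dots> = (\<integral>x. 2 * (f x * cos (of_real (fst x * t))) \<partial>lborel)"
    by (intro Bochner_Integration.integral_cong) (auto simp: cos_exp_eq field_simps)
  also have "\<dots> = 2 * (\<integral>x. f x * cos (of_real (fst x * t)) \<partial>lborel)"
    by simp
  finally show ?thesis
    by (simp add: t_def)
qed

section \<open>The square-mean transform of an integrable function\<close>

text \<open>The truncated integrals converge pointwise to the full one by dominated convergence.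
  Fatou's lemma then bounds its squared distance to \<open>h\<close> by the limit 0 of the truncated
  distances.\<close>

lemma fourier_L2_integrable:
  assumes "fourier_L2 f h" and f: "integrable lborel f"
  shows "AE \<sigma> in lborel. h \<sigma> = 1 / (2 * of_real pi) * (\<integral>x. f x * exp (- \<i> * of_real (x \<bullet> \<sigma>)) \<partial>lborel)"
    (is "AE \<sigma> in _. _ = ?F \<sigma>")
proof -
  let ?D = "\<lambda>R \<sigma>. ennreal ((cmod (fourier_trunc f R \<sigma> - h \<sigma>))\<^sup>2)"
  have [measurable]: "f \<in> borel_measurable borel" "h \<in> borel_measurable borel"
    using assms by (auto simp: fourier_L2_def in_L2_def)
  have [measurable]: "(\<lambda>x :: real \<times> real. exp (- \<i> * of_real (x \<bullet> \<sigma>))) \<in> borel_measurable borel" for \<sigma>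
    by (intro borel_measurable_continuous_onI continuous_intros)
  have [measurable]: "indicat_real (cball 0 R) \<in> borel_measurable (borel :: (real \<times> real) measure)" for R
    by (intro borel_measurable_indicator) simp
  \<comment> \<open>Fatou needs measurability in \<open>\<sigma>\<close>; it comes from joint
    measurability of the integrand in \<open>(\<sigma>, x)\<close>.\<close>
  have trunc_meas [measurable]: "fourier_trunc f R \<in> borel_measurable borel" for R
  proof -
    have "(\<lambda>(\<sigma>, x). indicator (cball 0 R) x *\<^sub>R (f x * exp (- \<i> * of_real (x \<bullet> \<sigma>))))
        \<in> borel_measurable (lborel \<Otimes>\<^sub>M lborel)"
    proof -
      have [measurable]: "(\<lambda>p :: (real \<times> real) \<times> (real \<times> real). exp (- \<i> * of_real (snd p \<bullet> fst p)))
          \<in> borel_measurable (borel \<Otimes>\<^sub>M borel)"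
        unfolding borel_prod by (intro borel_measurable_continuous_onI continuous_intros)
      have [measurable]: "(\<lambda>p :: (real \<times> real) \<times> (real \<times> real). indicat_real (cball 0 R) (snd p))
          \<in> borel_measurable (borel \<Otimes>\<^sub>M borel)"
        by (rule measurable_compose[OF measurable_snd]) measurable
      show ?thesis
        unfolding case_prod_beta by measurable
    qed
    then have "(\<lambda>\<sigma>. \<integral>x. indicator (cball 0 R) x *\<^sub>R (f x * exp (- \<i> * of_real (x \<bullet> \<sigma>))) \<partial>lborel)
        \<in> borel_measurable lborel"
      by (rule lborel.borel_measurable_lebesgue_integral)
    then show ?thesis
      unfolding fourier_trunc_def[abs_def] set_lebesgue_integral_def by measurable
  qed
  \<comment> \<open>Integer radii suffice and give a sequence, the form used by dominated
    convergence and Fatou.\<close>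
  have lim: "(\<lambda>n. fourier_trunc f (real n) \<sigma>) \<longlonglongrightarrow> ?F \<sigma>" for \<sigma>
    unfolding fourier_trunc_def set_lebesgue_integral_def
  proof (intro tendsto_mult tendsto_const integral_dominated_convergence)
    show "integrable lborel (\<lambda>x. cmod (f x))" using f by simp
    show "AE x in lborel. (\<lambda>n. indicator (cball 0 (real n)) x *\<^sub>R (f x * exp (- \<i> * of_real (x \<bullet> \<sigma>))))
        \<longlonglongrightarrow> f x * exp (- \<i> * of_real (x \<bullet> \<sigma>))"
    proof (rule AE_I2, rule tendsto_eventually)
      fix x :: "real \<times> real"
      show "\<forall>\<^sub>F n in sequentially. indicator (cball 0 (real n)) x *\<^sub>R (f x * exp (- \<i> * of_real (x \<bullet> \<sigma>)))
          = f x * exp (- \<i> * of_real (x \<bullet> \<sigma>))"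
        using eventually_ge_at_top[of "nat \<lceil>norm x\<rceil>"]
        by eventually_elim (auto simp: indicator_def)
    qed
    show "AE x in lborel. norm (indicator (cball 0 (real n)) x *\<^sub>R (f x * exp (- \<i> * of_real (x \<bullet> \<sigma>))))
        \<le> cmod (f x)" for n
      by (auto simp: norm_mult indicator_def)
  qed measurable
  have "(\<integral>\<^sup>+\<sigma>. ennreal ((cmod (?F \<sigma> - h \<sigma>))\<^sup>2) \<partial>lborel) = (\<integral>\<^sup>+\<sigma>. liminf (\<lambda>n. ?D (real n) \<sigma>) \<partial>lborel)"
  proof (rule nn_integral_cong)
    fix \<sigma>
    have "(\<lambda>n. ?D (real n) \<sigma>) \<longlonglongrightarrow> ennreal ((cmod (?F \<sigma> - h \<sigma>))\<^sup>2)"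
      by (intro tendsto_ennrealI tendsto_intros lim)
    then show "ennreal ((cmod (?F \<sigma> - h \<sigma>))\<^sup>2) = liminf (\<lambda>n. ?D (real n) \<sigma>)"
      by (intro lim_imp_Liminf[symmetric]) simp_all
  qed
  also have "\<dots> \<le> liminf (\<lambda>n. \<integral>\<^sup>+\<sigma>. ?D (real n) \<sigma> \<partial>lborel)"
    by (rule nn_integral_liminf) measurable
  also have "\<dots> = 0"
  proof (rule lim_imp_Liminf)
    show "(\<lambda>n. \<integral>\<^sup>+\<sigma>. ?D (real n) \<sigma> \<partial>lborel) \<longlonglongrightarrow> 0"
      using assms(1) unfolding fourier_L2_def
      by (auto intro: filterlim_compose[OF _ filterlim_real_sequentially])
  qed simp
  finally have "(\<integral>\<^sup>+\<sigma>. ennreal ((cmod (?F \<sigma> - h \<sigma>))\<^sup>2) \<partial>lborel) = 0"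
    by simp
  moreover have "?F \<in> borel_measurable borel"
    by (rule borel_measurable_LIMSEQ_metric[OF _ lim]) measurable
  ultimately have "AE \<sigma> in lborel. ennreal ((cmod (?F \<sigma> - h \<sigma>))\<^sup>2) = 0"
    by (subst (asm) nn_integral_0_iff_AE) auto
  then show ?thesis
    by eventually_elim simp
qed

section \<open>From the decay of \<open>g\<close> to the entire extension of
  \<open>G\<close>\<close>

theorem theorem4p4:
  fixes T :: real and g G :: "real \<Rightarrow> complex"
  assumes "T > 0"
    and "in_L2 Rplus g"
    and "is_Phi g G"
    and "in_Linf Rplus (\<lambda>r. of_real (exp (r / (4 * T))) * g r / of_real (ln (1 + 4 * T / r)))"
  shows "\<exists>Ge. entire_order1_type_le T Ge \<and> (AE \<rho> in Rplus. Ge (of_real \<rho>) = G \<rho>)"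
proof -
  define f where "f = Psi_inv g"
  have fourier: "fourier_L2 f (Psi_inv G)" and G: "in_L2 Rplus G"
    using assms(3) by (auto simp: is_Phi_def f_def)
  have [measurable]: "f \<in> borel_measurable borel"
    using fourier by (auto simp: fourier_L2_def in_L2_def)
  have fst_meas [measurable]: "(fst :: real \<times> real \<Rightarrow> real) \<in> borel_measurable borel"
    by (intro borel_measurable_continuous_onI continuous_intros)
  obtain C where C: "AE r in Rplus. cmod (of_real (exp (r / (4 * T))) * g r / of_real (ln (1 + 4 * T / r))) \<le> C"
    using assms(4) by (auto simp: in_Linf_def)
  have "AE r in Rplus. cmod (g r) \<le> C * (exp (- (r / (4 * T))) * ln (1 + 4 * T / r))"
    using C unfolding AE_Rplus_iff
  proof eventually_elim
    case (elim r)
    show ?case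
    proof
      assume "0 < r"
      then have "0 < 4 * T / r" using \<open>T > 0\<close> by simp
      then have "0 < ln (1 + 4 * T / r)" by (intro ln_gt_zero) linarith
      then show "cmod (g r) \<le> C * (exp (- (r / (4 * T))) * ln (1 + 4 * T / r))"
        using elim \<open>0 < r\<close> by (simp add: norm_mult norm_divide exp_minus field_simps)
    qed
  qed
  from AE_norm_square_plane[OF this]
  have f_le: "AE x in lborel. cmod (f x)
      \<le> C * (exp (- ((norm x)\<^sup>2 / (4 * T))) * ln (1 + 4 * T / (norm x)\<^sup>2))"
    by (simp add: f_def Psi_inv_def)
  have int_f: "integrable lborel (\<lambda>x. cmod (f x) * exp ((fst x)\<^sup>2 / (4 * c)))" if "c > T" for c
  proof -
    \<comment> \<open>The decay rate \<open>1 / (4 * T)\<close> of \<open>f\<close> minus the rate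
      \<open>1 / (4 * c)\<close> spent on the weight; it is positive because
      \<open>c > T\<close>.\<close>
    define a where "a = 1 / (4 * T) - 1 / (4 * c)"
    have "a > 0" using that \<open>T > 0\<close> by (simp add: a_def field_simps)
    then have "integrable lborel (\<lambda>x :: real \<times> real. C * (exp (- (a * (norm x)\<^sup>2)) * ln (1 + 4 * T / (norm x)\<^sup>2)))"
      using \<open>T > 0\<close>
      by (intro integrable_mult_right integrable_norm_square_plane set_integrable_exp_ln) auto
    then show ?thesis
    proof (rule Bochner_Integration.integrable_bound)
      show "AE x in lborel. norm (cmod (f x) * exp ((fst x)\<^sup>2 / (4 * c)))
        \<le> norm (C * (exp (- (a * (norm x)\<^sup>2)) * ln (1 + 4 * T / (norm x)\<^sup>2)))"
        using f_le
      proof eventually_elim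
        case (elim x)
        \<comment> \<open>Enlarging the weight from \<open>fst x\<close> to \<open>norm x\<close>
          makes the majorant radial, hence integrable through the half-line.\<close>
        have "(fst x)\<^sup>2 \<le> (norm x)\<^sup>2"
          by (simp add: norm_prod_def)
        then have "exp ((fst x)\<^sup>2 / (4 * c)) \<le> exp ((norm x)\<^sup>2 / (4 * c))"
          using that \<open>T > 0\<close> by (simp add: divide_right_mono)
        with elim have "cmod (f x) * exp ((fst x)\<^sup>2 / (4 * c))
          \<le> (C * (exp (- ((norm x)\<^sup>2 / (4 * T))) * ln (1 + 4 * T / (norm x)\<^sup>2))) * exp ((norm x)\<^sup>2 / (4 * c))"
          by (intro mult_mono') auto
        also have "\<dots> = C * (exp (- (a * (norm x)\<^sup>2)) * ln (1 + 4 * T / (norm x)\<^sup>2))"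
          by (simp add: a_def left_diff_distrib exp_diff exp_minus field_simps)
        finally show ?case by simp
      qed
    qed measurable
  qed
  have f_int: "integrable lborel f"
  proof (rule Bochner_Integration.integrable_bound[OF int_f[of "T + 1"]])
    \<comment> \<open>The weight is at least 1, so \<open>f\<close> inherits integrability from the
      weighted function.\<close>
    show "AE x in lborel. norm (f x) \<le> norm (cmod (f x) * exp ((fst x)\<^sup>2 / (4 * (T + 1))))"
      using \<open>T > 0\<close> by (auto intro!: AE_I2 simp: abs_mult mult_le_cancel_left1)
  qed auto
  \<comment> \<open>The transform at \<open>(sqrt z, 0)\<close>, in cosine form; the factor
    \<open>1 / (2 * pi)\<close> is absorbed into the function being transformed.\<close>
  define Ge where "Ge z = (\<integral>x. (1 / (2 * of_real pi) * f x) * cos (of_real (fst x) * csqrt z) \<partial>lborel)" for z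
  have "entire_order1_type_le T Ge"
    unfolding Ge_def[abs_def]
  proof (rule entire_cos_csqrt_transform)
    show "integrable lborel (\<lambda>x. cmod (1 / (2 * of_real pi) * f x) * exp ((fst x)\<^sup>2 / (4 * c)))"
      if "c > T" for c
      using integrable_mult_right[OF int_f[OF that], of "1 / (2 * pi)"]
      by (simp add: norm_mult norm_divide mult.assoc)
  qed (use \<open>T > 0\<close> in auto)
  moreover have "AE \<rho> in Rplus. Ge (of_real \<rho>) = G \<rho>"
  proof -
    \<comment> \<open>The guard is there for measurability: \<open>G\<close> is known to be Borel
      only on the positive half-line, and under the guard it may be replaced by its extension by
      0.\<close>
    let ?P = "\<lambda>\<rho>. 0 < \<rho> \<longrightarrow> Ge (of_real \<rho>) = G \<rho>"
    have "G \<in> borel_measurable (restrict_space borel {0<..})"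
      using G measurable_cong_sets[OF sets_restrict_space_cong[OF sets_lborel] refl]
      by (auto simp: in_L2_def Rplus_def)
    have "Ge holomorphic_on UNIV"
      using \<open>entire_order1_type_le T Ge\<close> unfolding entire_order1_type_le_def by blast
    then have "Ge \<in> borel_measurable borel"
      by (intro borel_measurable_continuous_onI holomorphic_on_imp_continuous_on)
    then have [measurable]: "(\<lambda>\<rho>. Ge (of_real \<rho>)) \<in> borel_measurable borel"
      by (rule measurable_compose[rotated]) simp
    have "(\<lambda>\<rho>. indicator {0<..} \<rho> *\<^sub>R G \<rho>) \<in> borel_measurable borel"
      using borel_measurable_restrict_space_iff[of "{0<..}" borel G] \<open>G \<in> _\<close> by simp
    then have "{\<rho>. 0 < \<rho> \<longrightarrow> Ge (of_real \<rho>) = indicator {0<..} \<rho> *\<^sub>R G \<rho>} \<in> sets borel"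
      by measurable
    then have meas: "{\<rho>. ?P \<rho>} \<in> sets borel"
      by (rule back_subst[of "\<lambda>S. S \<in> sets borel"]) auto
    \<comment> \<open>The line \<open>fst \<sigma> = 0\<close>, where the rotation argument does not
      apply, is a hyperplane and hence null.\<close>
    have "{\<sigma> :: real \<times> real. \<sigma> \<bullet> (1, 0) = 0} \<in> null_sets (completion lborel)"
      unfolding negligible_iff_null_sets[symmetric]
      by (rule negligible_standard_hyperplane) (simp add: Basis_prod_def)
    then have "{\<sigma> :: real \<times> real. \<sigma> \<bullet> (1, 0) = 0} \<in> null_sets lborel"
      by (subst (asm) null_sets_completion_iff)
        (simp_all add: borel_closed closed_Collect_eq continuous_intros del: inner_Pair_0)
    then have "AE \<sigma> in lborel. (\<sigma> :: real \<times> real) \<bullet> (1, 0) \<noteq> 0"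
      by (rule AE_I') auto
    then have "AE \<sigma> in lborel. ?P ((norm (\<sigma> :: real \<times> real))\<^sup>2)"
      using fourier_L2_integrable[OF fourier f_int]
    proof eventually_elim
      case (elim \<sigma>)
      have "G ((norm \<sigma>)\<^sup>2) = 1 / (2 * of_real pi) * (\<integral>x. f x * exp (- \<i> * of_real (x \<bullet> \<sigma>)) \<partial>lborel)"
        using elim(2) by (simp add: Psi_inv_def)
      also have "(\<integral>x. f x * exp (- \<i> * of_real (x \<bullet> \<sigma>)) \<partial>lborel)
          = (\<integral>x. f x * cos (of_real (fst x * norm \<sigma>)) \<partial>lborel)"
        using elim(1) by (cases \<sigma>) (intro integral_radial_fourier_plane f_int; auto simp: f_def Psi_inv_def)
      \<comment> \<open>At \<open>z = |\<sigma>|^2\<close> the principal root \<open>csqrt z\<close>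
        is \<open>|\<sigma>|\<close> itself.\<close>
      also have "1 / (2 * of_real pi) * \<dots> = Ge (of_real ((norm \<sigma>)\<^sup>2))"
        unfolding Ge_def by (simp add: csqrt_of_real_nonneg mult.assoc)
      finally show ?case by simp
    qed
    then have "AE \<rho> in Rplus. ?P \<rho>"
      by (subst (asm) AE_norm_square_plane_iff[OF meas])
    then show ?thesis
      by (simp add: AE_Rplus_iff)
  qed
  ultimately show ?thesis by blast
qed

end
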